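(* Let $k>1$ be an integer, let $a_1,\ldots,a_k\in\mathbb{Z}$ and $n_1,\ldots,n_k\in\mathbb{Z}^+$, and let $w:\mathbb{Z}\to\mathbb{Z}$ be the covering function $w(x)=|\{1\leqslant s\leqslant k:\ x\equiv a_s\ (\mathrm{mod}\ n_s)\}|$. Suppose that there exist $m\in\mathbb{Z}^+$ and $a\in\mathbb{Z}$ such that $w(x)\equiv a\ (\mathrm{mod}\ m)$ for all $x\in\mathbb{Z}$. Then, for any $t\in\{1,\ldots,k\}$ such that $mn_t$ does not divide $[n_1,\ldots,n_k]$ (the least common multiple of $n_1,\ldots,n_k$), there exists $s\in\{1,\ldots,k\}$ with $s\neq t$ and $n_t\mid n_s$.
   Context: For $a\in\mathbb{Z}$ and $n\in\mathbb{Z}^+$, $a(n)$ denotes the residue class $\{x\in\mathbb{Z}: x\equiv a\ (\mathrm{mod}\ n)\}$; the system under consideration is $\{a_s(n_s)\}_{s=1}^k$. *)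

theory Defs
  imports Complex_Main "HOL-Number_Theory.Cong"
begin

text \<open>
  A system of \<open>k\<close> residue classes is given by the residues \<open>a\<close> and the moduli \<open>n\<close>,
  of which only the values at the indices \<open>1, \<dots>, k\<close> matter.  Indices, not classes, are
  counted: a residue class that occurs several times in the system contributes several times.
\<close>

definition covering_function :: "nat \<Rightarrow> (nat \<Rightarrow> int) \<Rightarrow> (nat \<Rightarrow> int) \<Rightarrow> int \<Rightarrow> int"
  where "covering_function k a n x = int (card {s \<in> {1..k}. [x = a s] (mod n s)})"

end

theory Submission
  imports Defs "HOL-Library.Periodic_Fun"
begin

text \<open>
  Let \<open>N\<close> be the least common multiple of the moduli and \<open>d = n t\<close>. Folding a function of period
  \<open>N\<close> onto period \<open>d\<close>, i.e. summing it over the shifts by multiples of \<open>d\<close>, turns the indicator of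
  the class of index \<open>s\<close> into a function with the periods \<open>d\<close> and \<open>n s\<close>. If \<open>d\<close> does not divide \<open>n s\<close>, this
  function has period \<open>d / q\<close> for some prime \<open>q\<close> dividing \<open>d\<close>, and so it is annihilated by the
  operator \<open>\<Prod>\<^bsub>p | d\<^esub> (1 - T\<^bsup>d/p\<^esup>)\<close>, where \<open>T\<close> is the unit shift; constants are annihilated as
  well. The indicator of the class of index \<open>t\<close> folds to \<open>N / d\<close> times itself, and the operator does not
  change its value at \<open>a t\<close>, since no nonempty sum of distinct \<open>1 / p\<close> is an integer. If \<open>d\<close> divides no
  other modulus, applying the operator to the folded covering function modulo \<open>m\<close> therefore gives
  \<open>m | N / d\<close>.
\<close>

definition fold_sum :: "int \<Rightarrow> nat \<Rightarrow> (int \<Rightarrow> int) \<Rightarrow> int \<Rightarrow> int"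
  where "fold_sum d M f x = (\<Sum>j<M. f (x + d * int j))"

text \<open>The operator \<open>\<Prod>\<^bsub>p | d\<^esub> (1 - T\<^bsup>d/p\<^esup>)\<close>, multiplied out.\<close>

definition alt_shift :: "int \<Rightarrow> (int \<Rightarrow> int) \<Rightarrow> int \<Rightarrow> int"
  where "alt_shift d f x =
    (\<Sum>S\<in>Pow (prime_factors d). (- 1) ^ card S * f (x + (\<Sum>p\<in>S. d div p)))"

lemma periodic_mult:
  fixes f :: "int \<Rightarrow> 'a"
  assumes "\<And>x. f (x + p) = f x"
  shows "f (x + p * k) = f x"
proof -
  interpret periodic_fun_simple f p
    by standard (rule assms)
  show ?thesis
    using plus_of_int[of x k] by (simp add: mult.commute)
qed

lemma fold_sum_sum: "fold_sum d M (\<lambda>x. \<Sum>s\<in>A. f s x) x = (\<Sum>s\<in>A. fold_sum d M (f s) x)"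
  unfolding fold_sum_def by (rule sum.swap)

lemma fold_sum_shift:
  assumes "\<And>x. f (x + d * int M) = f x"
  shows "fold_sum d M f (x + d) = fold_sum d M f x"
proof -
  \<comment> \<open>Extend the sum by one term: dropping the first or the last term gives the two
    folds, and these terms agree by periodicity.\<close>
  have "fold_sum d M f (x + d) + f x = (\<Sum>j<Suc M. f (x + d * int j))"
    unfolding fold_sum_def sum.lessThan_Suc_shift by (simp add: algebra_simps)
  also have "\<dots> = fold_sum d M f x + f x"
    using assms by (simp add: fold_sum_def)
  finally show ?thesis
    by simp
qed

lemma alt_shift_sum: "alt_shift d (\<lambda>x. \<Sum>s\<in>A. f s x) x = (\<Sum>s\<in>A. alt_shift d (f s) x)"
  unfolding alt_shift_def sum_distrib_left by (rule sum.swap)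

lemma alt_shift_cong:
  assumes "\<And>x. [f x = g x] (mod m)"
  shows "[alt_shift d f x = alt_shift d g x] (mod m)"
  unfolding alt_shift_def by (intro cong_sum cong_mult cong_refl assms)

text \<open>The factor belonging to \<open>q\<close> kills \<open>f\<close>: the terms for
  \<open>S\<close> and \<open>insert q S\<close>, with \<open>q\<close> not in \<open>S\<close>,
  cancel in pairs.\<close>

lemma alt_shift_eq_0:
  assumes q: "q \<in> prime_factors d" and per: "\<And>x. f (x + d div q) = f x"
  shows "alt_shift d f x = 0"
proof -
  define P where "P = prime_factors d - {q}"
  define h where "h S = (- 1) ^ card S * f (x + (\<Sum>p\<in>S. d div p))" for S
  have P: "prime_factors d = insert q P" "q \<notin> P" "finite P"
    using q by (auto simp: P_def)
  have h_insert: "h (insert q S) = - h S" if "S \<in> Pow P" for S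
  proof -
    have "finite S" "q \<notin> S"
      using that P finite_subset by auto
    then show ?thesis
      using per[of "x + (\<Sum>p\<in>S. d div p)"] by (simp add: h_def ac_simps)
  qed
  have "inj_on (insert q) (Pow P)"
    using P by (auto simp: inj_on_def)
  then have "alt_shift d f x = (\<Sum>S\<in>Pow P. h S) + (\<Sum>S\<in>Pow P. h (insert q S))"
    unfolding alt_shift_def P(1) Pow_insert h_def[symmetric] using P(2,3)
    by (subst sum.union_disjoint) (auto simp: sum.reindex)
  also have "\<dots> = 0"
    by (simp add: h_insert sum_negf)
  finally show ?thesis .
qed

text \<open>For \<open>q\<close> in \<open>S\<close>, the full power of \<open>q\<close> in
  \<open>d\<close> divides every summand except \<open>d div q\<close>, hence not the sum.\<close>

lemma not_dvd_sum_div_primes: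
  fixes d :: int
  assumes "d > 0" "S \<subseteq> prime_factors d" "S \<noteq> {}"
  shows "\<not> d dvd (\<Sum>p\<in>S. d div p)"
proof
  assume dvd: "d dvd (\<Sum>p\<in>S. d div p)"
  obtain q where q: "q \<in> S"
    using assms(3) by blast
  define e where "e = multiplicity q d"
  have fin: "finite S"
    using assms(2) finite_subset by auto
  have prime: "prime p" "p dvd d" if "p \<in> S" for p
    using that assms(2) by auto
  have qe: "q ^ e dvd d"
    by (simp add: e_def multiplicity_dvd)
  have "q ^ e dvd (\<Sum>p\<in>S - {q}. d div p)"
  proof (rule dvd_sum)
    fix p assume p: "p \<in> S - {q}"
    then have "coprime (q ^ e) p"
      using prime q by (simp add: primes_coprime)
    moreover have "q ^ e dvd p * (d div p)"
      using qe p prime by simp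
    ultimately show "q ^ e dvd d div p"
      by (simp add: coprime_dvd_mult_right_iff)
  qed
  moreover have "q ^ e dvd d div q + (\<Sum>p\<in>S - {q}. d div p)"
    using dvd_trans[OF qe dvd] sum.remove[OF fin q, of "\<lambda>p. d div p"] by simp
  ultimately have "q ^ e dvd d div q"
    by (simp add: dvd_add_left_iff)
  then have "q * q ^ e dvd q * (d div q)"
    by (rule mult_dvd_mono[OF dvd_refl])
  then have "q ^ Suc e dvd d"
    using prime[OF q] by simp
  moreover have "\<not> q ^ Suc e dvd d"
    unfolding e_def using assms(1) prime[OF q] by (subst power_dvd_iff_le_multiplicity) auto
  ultimately show False
    by simp
qed

lemma alt_shift_indicator:
  assumes "d > 0"
  shows "alt_shift d (\<lambda>x. c * of_bool [x = a] (mod d)) a = c"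
proof -
  have "alt_shift d (\<lambda>x. c * of_bool [x = a] (mod d)) a
      = (\<Sum>S\<in>Pow (prime_factors d). if S = {} then c else 0)"
    unfolding alt_shift_def
  proof (rule sum.cong[OF refl])
    fix S assume "S \<in> Pow (prime_factors d)"
    then have "\<not> [a + (\<Sum>p\<in>S. d div p) = a] (mod d)" if "S \<noteq> {}"
      using not_dvd_sum_div_primes[OF assms, of S] that by (simp add: cong_iff_dvd_diff)
    then show "(- 1) ^ card S * (c * of_bool [a + (\<Sum>p\<in>S. d div p) = a] (mod d))
        = (if S = {} then c else 0)"
      by auto
  qed
  then show ?thesis
    by simp
qed

text \<open>By Bezout, \<open>gcd d e\<close> is a period. It is a proper divisor of
  \<open>d\<close>, so any prime \<open>q\<close> dividing the cofactor makes \<open>d div q\<close>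
  a multiple of it.\<close>

lemma exists_prime_factor_period:
  fixes d e :: int and f :: "int \<Rightarrow> 'a"
  assumes "d > 0" "\<not> d dvd e"
    and per_d: "\<And>x. f (x + d) = f x" and per_e: "\<And>x. f (x + e) = f x"
  shows "\<exists>q\<in>prime_factors d. \<forall>x. f (x + d div q) = f x"
proof -
  define g where "g = gcd d e"
  obtain r where r: "d = g * r"
    unfolding g_def by (meson dvdE gcd_dvd1)
  have "\<not> is_unit r"
  proof
    assume "is_unit r"
    then have "d dvd g"
      by (simp add: r mult_unit_dvd_iff)
    then show False
      using assms(2) by (simp add: g_def)
  qed
  moreover have "r \<noteq> 0"
    using r assms(1) by auto
  ultimately obtain q where q: "prime q" "q dvd r"
    using prime_divisor_exists by blast
  then obtain l where l: "r = q * l"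
    by blast
  obtain u v where uv: "u * d + v * e = g"
    unfolding g_def by (metis bezout_int)
  have "d div q = g * l"
    using q(1) r l by auto
  then have "d div q = d * (u * l) + e * (v * l)"
    by (simp add: uv[symmetric] algebra_simps)
  then have "f (x + d div q) = f x" for x
    using periodic_mult[of f e "x + d * (u * l)" "v * l", OF per_e]
      periodic_mult[of f d x "u * l", OF per_d] by (simp add: add.assoc)
  moreover have "q \<in> prime_factors d"
    using q r assms(1) by (auto simp: in_prime_factors_iff)
  ultimately show ?thesis
    by blast
qed

theorem theorem1p1:
  fixes k t :: nat and a n :: "nat \<Rightarrow> int" and m b :: int
  assumes "k > 1"
    and "\<And>s. s \<in> {1..k} \<Longrightarrow> n s > 0"
    and "m > 0"
    and "\<And>x. [covering_function k a n x = b] (mod m)"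
    and "t \<in> {1..k}"
    and "\<not> m * n t dvd (LCM s\<in>{1..k}. n s)"
  shows "\<exists>s\<in>{1..k}. s \<noteq> t \<and> n t dvd n s"
proof (rule ccontr)
  assume "\<not> ?thesis"
  then have not_dvd: "\<not> n t dvd n s" if "s \<in> {1..k} - {t}" for s
    using that by auto
  define N where "N = (LCM s\<in>{1..k}. n s)"
  define d where "d = n t"
  define M where "M = nat (N div d)"
  define ind where "ind s x = (of_bool [x = a s] (mod n s) :: int)" for s x
  have d: "d > 0"
    using assms(2,5) by (simp add: d_def)
  have dvd_N: "n s dvd N" if "s \<in> {1..k}" for s
    unfolding N_def using that by (intro dvd_Lcm) auto
  have "N \<ge> 0"
    by (simp add: N_def)
  then have "int M = N div d"
    using d by (simp add: M_def pos_imp_zdiv_nonneg_iff)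
  then have N: "N = d * int M"
    using dvd_N[OF assms(5)] by (simp add: d_def)

  have ind_per: "ind s (x + n s * j) = ind s x" for s x j
    by (simp add: ind_def cong_def)
  have fold_per_d: "fold_sum d M (ind s) (x + d) = fold_sum d M (ind s) x" if "s \<in> {1..k}" for s x
  proof (rule fold_sum_shift)
    obtain j where "N = n s * j"
      using dvd_N[OF \<open>s \<in> {1..k}\<close>] by blast
    then show "ind s (y + d * int M) = ind s y" for y
      using ind_per N by metis
  qed
  have fold_per: "fold_sum d M (ind s) (x + n s) = fold_sum d M (ind s) x" for s x
    using ind_per[of s "x + d * int j" 1 for j] by (simp add: fold_sum_def ac_simps)
  have other: "alt_shift d (fold_sum d M (ind s)) x = 0" if s: "s \<in> {1..k} - {t}" for s x
  proof -
    obtain q where "q \<in> prime_factors d"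
        "\<forall>x. fold_sum d M (ind s) (x + d div q) = fold_sum d M (ind s) x"
      using exists_prime_factor_period[of d "n s" "fold_sum d M (ind s)"]
        d not_dvd[OF s] fold_per_d fold_per s d_def by blast
    then show ?thesis
      by (intro alt_shift_eq_0) auto
  qed

  \<comment> \<open>Since \<open>d = n t\<close>, all \<open>M\<close> shifts leave
    \<open>ind t\<close> unchanged.\<close>
  have "fold_sum d M (ind t) = (\<lambda>x. int M * of_bool [x = a t] (mod d))"
    using ind_per[of t] by (simp add: fold_sum_def fun_eq_iff flip: d_def) (simp add: ind_def d_def)
  then have own: "alt_shift d (fold_sum d M (ind t)) (a t) = int M"
    using alt_shift_indicator[OF d] by simp

  have w: "covering_function k a n = (\<lambda>x. \<Sum>s\<in>{1..k}. ind s x)"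
    by (simp add: covering_function_def ind_def fun_eq_iff sum.If_cases of_bool_def Int_def)
  have "alt_shift d (fold_sum d M (covering_function k a n)) (a t)
      = (\<Sum>s\<in>{1..k}. alt_shift d (fold_sum d M (ind s)) (a t))"
    unfolding w fold_sum_sum[abs_def] alt_shift_sum ..
  also have "\<dots> = int M"
    using assms(5) other own by (simp add: sum.remove[of _ t])
  finally have "[int M = alt_shift d (\<lambda>x. int M * b) (a t)] (mod m)"
    using alt_shift_cong[of "fold_sum d M (covering_function k a n)" "\<lambda>x. int M * b" m d "a t"]
      cong_sum[of "{..<M}" _ "\<lambda>_. b" m] assms(4) by (simp add: fold_sum_def)
  moreover have "alt_shift d (\<lambda>x. int M * b) (a t) = 0"
  proof -
    \<comment> \<open>Constants are killed only if \<open>d\<close> has a prime factor. A second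
      index, available as \<open>k > 1\<close>, excludes \<open>d = 1\<close>, because 1 would
      divide its modulus.\<close>
    obtain s where "s \<in> {1..k} - {t}"
      using assms(1) by (metis Diff_iff One_nat_def atLeastAtMost_iff empty_iff insert_iff
          le_refl less_imp_le nat_neq_iff)
    then have "\<not> d dvd n s"
      using not_dvd by (simp add: d_def)
    then obtain q where "q \<in> prime_factors d"
      \<comment> \<open>The zero function has every period; only the existence of \<open>q\<close>
        matters here.\<close>
      using exists_prime_factor_period[of d "n s" "\<lambda>x. x - x"] d by auto
    then show ?thesis
      by (intro alt_shift_eq_0) auto
  qed
  ultimately have "m dvd int M"
    by (simp add: cong_0_iff)
  then have "m * n t dvd N"
    by (simp add: N d_def mult.commute)
  then show False
    using assms(6) by (simp add: N_def)
qed

end
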